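(* The transformation $\mathscr J\colon(t,x,u)\mapsto(t,-x,u)$ is a pseudo-discrete element of the essential point symmetry group $G^{\rm ess}$ of the heat equation $u_t=u_{xx}$.
   Context: Given a Lie group $G$ with Lie algebra $\mathfrak g$ and identity component $G_{\rm id}$ such that $\exp(\mathfrak g)\ne G_{\rm id}$, an element $g\in G$ is called pseudo-discrete if $g\big(G_{\rm id}\setminus\exp(\mathfrak g)\big)\subseteq\exp(\mathfrak g)$. $G^{\rm ess}$ is the six-dimensional Lie group of transformations $$\tilde t=\frac{\alpha t+\beta}{\gamma t+\delta},\quad \tilde x=\frac{x+\lambda_1t+\lambda_0}{\gamma t+\delta},\quad \tilde u=\sigma\sqrt{|\gamma t+\delta|}\,\exp\!\left(\frac{\gamma (x+\lambda_1t+\lambda_0)^2}{4(\gamma t+\delta)}-\frac{\lambda_1}2x-\frac{\lambda_1^2}4t\right)u$$ with real parameters, $\alpha\delta-\beta\gamma=1$, $\sigma\ne0$, each considered on its natural domain $\{(t,x,u)\in\mathbb R^3\mid\gamma t+\delta\ne0\}$. The multiplication is the modified composition: the product of $\Phi_1$ and $\Phi_2$ is the transformation of this form that has the same parameters as the usual composition $\Phi_1\circ\Phi_2$ and is considered on its natural domain. The transformation $\mathscr J$ corresponds to $\alpha=\delta=-1$, $\beta=\gamma=\lambda_1=\lambda_0=0$, $\sigma=1$. The Lie algebra of $G^{\rm ess}$ is spanned by the vector fields $\partial_t$, $2t\partial_t+x\partial_x-\tfrac12u\partial_u$, $t^2\partial_t+tx\partial_x-\tfrac14(x^2+2t)u\partial_u$,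 $t\partial_x-\tfrac12xu\partial_u$, $\partial_x$, $u\partial_u$. *)

theory Defs
  imports "HOL-Analysis.Analysis" "HOL-Algebra.Group"
begin

section \<open>Pseudo-discrete elements\<close>

text \<open>
  A Lie group enters through its group structure \<open>G\<close>, its topology \<open>T\<close> and the image \<open>E\<close> of its
  exponential map. Non-surjectivity of the exponential map onto the identity component, under
  which the notion is introduced, is part of the definition.
\<close>

definition identity_component :: "('a, 'b) monoid_scheme \<Rightarrow> 'a topology \<Rightarrow> 'a set"
  where "identity_component G T = connected_component_of_set T \<one>\<^bsub>G\<^esub>"

definition pseudo_discrete ::
  "('a, 'b) monoid_scheme \<Rightarrow> 'a topology \<Rightarrow> 'a set \<Rightarrow> 'a \<Rightarrow> bool"
  where "pseudo_discrete G T E g \<longleftrightarrow>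
    E \<noteq> identity_component G T \<and>
    g \<in> carrier G \<and>
    (\<lambda>h. g \<otimes>\<^bsub>G\<^esub> h) ` (identity_component G T - E) \<subseteq> E"


section \<open>The essential point symmetry group of the heat equation\<close>

text \<open>Points are triples \<open>(t, x, u)\<close>; a transformation is a partial map whose domain is its
  natural domain. Parameter tuples are \<open>(\<alpha>, \<beta>, \<gamma>, \<delta>, \<lambda>\<^sub>1, \<lambda>\<^sub>0, \<sigma>)\<close>.\<close>

type_synonym point = "real \<times> real \<times> real"

type_synonym params = "real \<times> real \<times> real \<times> real \<times> real \<times> real \<times> real"

definition ess_params :: "params set"
  where "ess_params = {(\<alpha>, \<beta>, \<gamma>, \<delta>, l1, l0, \<sigma>). \<alpha> * \<delta> - \<beta> * \<gamma> = 1 \<and> \<sigma> \<noteq> 0}"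

definition ess_trans :: "params \<Rightarrow> point \<rightharpoonup> point"
  where "ess_trans = (\<lambda>(\<alpha>, \<beta>, \<gamma>, \<delta>, l1, l0, \<sigma>) (t, x, u).
    if \<gamma> * t + \<delta> \<noteq> 0
    then Some ((\<alpha> * t + \<beta>) / (\<gamma> * t + \<delta>),
               (x + l1 * t + l0) / (\<gamma> * t + \<delta>),
               \<sigma> * sqrt \<bar>\<gamma> * t + \<delta>\<bar> *
                 exp (\<gamma> * (x + l1 * t + l0)\<^sup>2 / (4 * (\<gamma> * t + \<delta>)) - l1 / 2 * x - l1\<^sup>2 / 4 * t) * u)
    else None)"

definition ess_carrier :: "(point \<rightharpoonup> point) set"
  where "ess_carrier = ess_trans ` ess_params"

text \<open>The modified composition: the usual composition \<open>\<Phi>\<^sub>1 \<circ>\<^sub>m \<Phi>\<^sub>2\<close> need not be defined on the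
  whole natural domain of the transformation with the same parameters, so the product is the
  element of the family that extends it (unique by \<open>ess_mult_trans\<close> below).\<close>

definition ess_mult :: "(point \<rightharpoonup> point) \<Rightarrow> (point \<rightharpoonup> point) \<Rightarrow> (point \<rightharpoonup> point)"
  where "ess_mult \<Phi>\<^sub>1 \<Phi>\<^sub>2 = (THE \<Phi>. \<Phi> \<in> ess_carrier \<and> (\<Phi>\<^sub>1 \<circ>\<^sub>m \<Phi>\<^sub>2) \<subseteq>\<^sub>m \<Phi>)"

definition ess_group :: "(point \<rightharpoonup> point) monoid"
  where "ess_group = \<lparr>carrier = ess_carrier, mult = ess_mult, one = Some\<rparr>"

text \<open>The manifold topology, transported from the parameter space, a subspace of the
  seven-dimensional Euclidean space; \<open>ess_trans\<close> is injective on the parameter space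
  (\<open>inj_on_ess_trans\<close> below).\<close>

definition ess_topology :: "(point \<rightharpoonup> point) topology"
  where "ess_topology = pullback_topology ess_carrier (inv_into ess_params ess_trans) euclidean"

definition transf_J :: "point \<rightharpoonup> point"
  where "transf_J = (\<lambda>(t, x, u). Some (t, - x, u))"


section \<open>Lie algebra and exponential map\<close>

text \<open>A vector field \<open>\<tau> \<partial>\<^sub>t + \<xi> \<partial>\<^sub>x + \<eta> \<partial>\<^sub>u\<close> is the map \<open>(t, x, u) \<mapsto> (\<tau>, \<xi>, \<eta>)\<close>.\<close>

definition field_Pt :: "point \<Rightarrow> point"
  where "field_Pt = (\<lambda>(t, x, u). (1, 0, 0))"

definition field_D :: "point \<Rightarrow> point"
  where "field_D = (\<lambda>(t, x, u). (2 * t, x, - (1 / 2) * u))"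

definition field_K :: "point \<Rightarrow> point"
  where "field_K = (\<lambda>(t, x, u). (t\<^sup>2, t * x, - (1 / 4) * (x\<^sup>2 + 2 * t) * u))"

definition field_Gx :: "point \<Rightarrow> point"
  where "field_Gx = (\<lambda>(t, x, u). (0, t, - (1 / 2) * x * u))"

definition field_Px :: "point \<Rightarrow> point"
  where "field_Px = (\<lambda>(t, x, u). (0, 1, 0))"

definition field_I :: "point \<Rightarrow> point"
  where "field_I = (\<lambda>(t, x, u). (0, 0, u))"

definition ess_algebra :: "(point \<Rightarrow> point) set"
  where "ess_algebra = {Q. \<exists>a b c d e f :: real. Q = (\<lambda>z.
    a *\<^sub>R field_Pt z + b *\<^sub>R field_D z + c *\<^sub>R field_K z +
    d *\<^sub>R field_Gx z + e *\<^sub>R field_Px z + f *\<^sub>R field_I z)}"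

text \<open>One-parameter subgroups of the Lie group, and their infinitesimal generators. Continuity
  and \<open>\<phi> 0 = Some\<close> ensure that each point \<open>z\<close> lies in the domain of \<open>\<phi> s\<close> for \<open>s\<close> near \<open>0\<close>.\<close>

definition one_param_subgroup :: "(real \<Rightarrow> (point \<rightharpoonup> point)) \<Rightarrow> bool"
  where "one_param_subgroup \<phi> \<longleftrightarrow>
    continuous_map euclideanreal ess_topology \<phi> \<and>
    (\<forall>s. \<phi> s \<in> carrier ess_group) \<and>
    (\<forall>r s. \<phi> (r + s) = \<phi> r \<otimes>\<^bsub>ess_group\<^esub> \<phi> s)"

definition generates :: "(point \<Rightarrow> point) \<Rightarrow> (real \<Rightarrow> (point \<rightharpoonup> point)) \<Rightarrow> bool"
  where "generates Q \<phi> \<longleftrightarrow>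
    one_param_subgroup \<phi> \<and>
    (\<forall>z. ((\<lambda>s. the (\<phi> s z)) has_vector_derivative Q z) (at 0))"

text \<open>The exponential of \<open>Q\<close> is the value at \<open>1\<close> of the one-parameter subgroup generated by \<open>Q\<close>;
  this is the image of the Lie algebra under it.\<close>

definition ess_exp_image :: "(point \<rightharpoonup> point) set"
  where "ess_exp_image = {\<phi> 1 | \<phi> Q. Q \<in> ess_algebra \<and> generates Q \<phi>}"


section \<open>Well-definedness of the group structure\<close>

lemma ess_trans_apply:
  "ess_trans (\<alpha>, \<beta>, \<gamma>, \<delta>, l1, l0, \<sigma>) (t, x, u) =
    (if \<gamma> * t + \<delta> \<noteq> 0
    then Some ((\<alpha> * t + \<beta>) / (\<gamma> * t + \<delta>),
               (x + l1 * t + l0) / (\<gamma> * t + \<delta>),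
               \<sigma> * sqrt \<bar>\<gamma> * t + \<delta>\<bar> *
                 exp (\<gamma> * (x + l1 * t + l0)\<^sup>2 / (4 * (\<gamma> * t + \<delta>)) - l1 / 2 * x - l1\<^sup>2 / 4 * t) * u)
    else None)"
  by (simp add: ess_trans_def)

lemma affine_eqI:
  fixes a b c d :: real
  assumes "finite F" and "\<And>t. t \<notin> F \<Longrightarrow> a * t + b = c * t + d"
  shows "a = c" "b = d"
proof -
  obtain t where t: "t \<notin> F"
    using ex_new_if_finite[OF infinite_UNIV_char_0 assms(1)] by blast
  obtain s where s: "s \<notin> insert t F"
    using ex_new_if_finite[OF infinite_UNIV_char_0 finite.insertI[OF assms(1)]] by blast
  have "(a - c) * (t - s) = 0"
    using assms(2)[of t] assms(2)[of s] t s by (simp add: algebra_simps)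
  then show "a = c" using s by auto
  with assms(2)[of t] t show "b = d" by simp
qed

lemma affine_zeros_finite:
  fixes a b :: real
  assumes "a \<noteq> 0 \<or> b \<noteq> 0"
  shows "finite {t. a * t + b = 0}"
proof (cases "a = 0")
  case False
  then have "{t. a * t + b = 0} \<subseteq> {- b / a}"
    by (auto simp: field_simps)
  then show ?thesis by (rule finite_subset) simp
qed (use assms in auto)

lemma ess_trans_eqI:
  assumes p: "p \<in> ess_params" and q: "q \<in> ess_params" and F: "finite F"
    and eq: "\<And>t x u. t \<notin> F \<Longrightarrow> ess_trans p (t, x, u) = ess_trans q (t, x, u)"
  shows "p = q"
proof -
  obtain a b c d k l s where p': "p = (a, b, c, d, k, l, s)" by (metis prod_cases7)
  obtain a' b' c' d' k' l' s' where q': "q = (a', b', c', d', k', l', s')" by (metis prod_cases7)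
  have det: "a * d - b * c = 1" "s \<noteq> 0" "a' * d' - b' * c' = 1" "s' \<noteq> 0"
    using p q by (auto simp: p' q' ess_params_def)
  define F' where "F' = F \<union> {t. c * t + d = 0} \<union> {t. c' * t + d' = 0}"
  have F': "finite F'"
    unfolding F'_def using F det
    by (intro finite_UnI affine_zeros_finite) (auto simp del: de_Morgan_conj de_Morgan_disj)
  have E: "(a * t + b) / (c * t + d) = (a' * t + b') / (c' * t + d')"
    "(x + k * t + l) / (c * t + d) = (x + k' * t + l') / (c' * t + d')" 
    "s * sqrt \<bar>c * t + d\<bar> * exp (c * (x + k * t + l)\<^sup>2 / (4 * (c * t + d)) - k / 2 * x - k\<^sup>2 / 4 * t) * u
    = s' * sqrt \<bar>c' * t + d'\<bar> * exp (c' * (x + k' * t + l')\<^sup>2 / (4 * (c' * t + d')) - k' / 2 * x - k'\<^sup>2 / 4 * t) * u"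
    "c * t + d \<noteq> 0" "c' * t + d' \<noteq> 0" if "t \<notin> F'" for t x u
    using eq[of t x u] that by (auto simp: p' q' ess_trans_apply F'_def)
  have den: "c * t + d = c' * t + d'" if t: "t \<notin> F'" for t
  proof -
    have "1 / (c * t + d) = 1 / (c' * t + d')"
      using E(2)[OF t, of 1] E(2)[OF t, of 0] unfolding add_divide_distrib by linarith
    then have "inverse (c * t + d) = inverse (c' * t + d')" by (simp only: inverse_eq_divide)
    then show ?thesis by simp
  qed
  have cd: "c = c'" "d = d'" using affine_eqI[OF F' den] by auto
  have ab: "a = a'" "b = b'"
    using affine_eqI[OF F', of a b a' b'] E(1) E(4) cd by auto
  have kl: "k = k'" "l = l'"
    using affine_eqI[OF F', of k l k' l'] E(2)[where x = 0] E(4) cd by auto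
  obtain t where t: "t \<notin> F'"
    using ex_new_if_finite[OF infinite_UNIV_char_0 F'] by blast
  have "s = s'" using E(3)[OF t, of 0 1] E(4)[OF t] by (simp add: cd ab kl)
  then show ?thesis by (simp add: p' q' ab cd kl)
qed

lemma inj_on_ess_trans: "inj_on ess_trans ess_params"
  by (rule inj_onI, rule ess_trans_eqI[where F = "{}"]) auto

lemma transf_J_eq: "transf_J = ess_trans (-1, 0, 0, -1, 0, 0, 1)"
  by (auto simp: transf_J_def ess_trans_apply fun_eq_iff)

lemma Some_eq_ess_trans: "Some = ess_trans (1, 0, 0, 1, 0, 0, 1)"
  by (auto simp: ess_trans_apply fun_eq_iff)

fun ess_pmult :: "params \<Rightarrow> params \<Rightarrow> params" where
  "ess_pmult (a1, b1, c1, d1, k1, l1, s1) (a2, b2, c2, d2, k2, l2, s2) =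
    (a1 * a2 + b1 * c2, a1 * b2 + b1 * d2, c1 * a2 + d1 * c2, c1 * b2 + d1 * d2,
     k2 + (k1 * a2 + l1 * c2), l2 + (k1 * b2 + l1 * d2),
     s1 * s2 * exp (- (k1\<^sup>2 * a2 * b2 + 2 * k1 * l1 * b2 * c2 + l1\<^sup>2 * c2 * d2) / 4
                    - (k1 * a2 + l1 * c2) * l2 / 2))"

lemma ess_pmult_in_params: "p \<in> ess_params \<Longrightarrow> q \<in> ess_params \<Longrightarrow> ess_pmult p q \<in> ess_params"
proof -
  have "(a1 * a2 + b1 * c2) * (c1 * b2 + d1 * d2) - (a1 * b2 + b1 * d2) * (c1 * a2 + d1 * c2) =
    (a1 * d1 - b1 * c1) * (a2 * d2 - b2 * c2)" for a1 a2 b1 b2 c1 c2 d1 d2 :: real by algebra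
  then show "p \<in> ess_params \<Longrightarrow> q \<in> ess_params \<Longrightarrow> ess_pmult p q \<in> ess_params"
    by (auto simp: ess_params_def)
qed

lemma exponent_identity:
  fixes c1 :: real
  assumes det: "a2 * d2 - b2 * c2 = 1"
    and P: "P = c2 * t + d2" "P \<noteq> 0" and R: "R = c1 * (a2 * t + b2) + d1 * P" "R \<noteq> 0"
  shows "c1 * ((x + k2 * t + l2) / P + k1 * ((a2 * t + b2) / P) + l1)\<^sup>2 / (4 * (R / P))
      - k1 / 2 * ((x + k2 * t + l2) / P) - k1\<^sup>2 / 4 * ((a2 * t + b2) / P)
      + (c2 * (x + k2 * t + l2)\<^sup>2 / (4 * P) - k2 / 2 * x - k2\<^sup>2 / 4 * t)
    = (- (k1\<^sup>2 * a2 * b2 + 2 * k1 * l1 * b2 * c2 + l1\<^sup>2 * c2 * d2) / 4 - (k1 * a2 + l1 * c2) * l2 / 2)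
      + ((c1 * a2 + d1 * c2) * (x + (k2 + (k1 * a2 + l1 * c2)) * t + (l2 + (k1 * b2 + l1 * d2)))\<^sup>2 / (4 * R)
      - (k2 + (k1 * a2 + l1 * c2)) / 2 * x - (k2 + (k1 * a2 + l1 * c2))\<^sup>2 / 4 * t)"
proof -
  define Y where "Y = x + k2 * t + l2"
  define m where "m = k1 * a2 + l1 * c2"
  define n where "n = k1 * b2 + l1 * d2"
  define Z where "Z = Y + m * t + n"
  have k1: "k1 = m * d2 - n * c2"
  proof -
    have "m * d2 - n * c2 = k1 * (a2 * d2 - b2 * c2)" by (simp add: m_def n_def algebra_simps)
    then show ?thesis using det by simp
  qed
  have l1: "l1 = n * a2 - m * b2"
  proof -
    have "n * a2 - m * b2 = l1 * (a2 * d2 - b2 * c2)" by (simp add: m_def n_def algebra_simps)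
    then show ?thesis using det by simp
  qed
  have x: "x = Y - k2 * t - l2" by (simp add: Y_def)
  have 1: "Y / P + k1 * ((a2 * t + b2) / P) + l1 = Z / P"
  proof -
    have "Z = Y + k1 * (a2 * t + b2) + l1 * P"
      by (simp add: Z_def m_def n_def P(1) algebra_simps)
    then show ?thesis using P(2) by (simp add: field_simps)
  qed
  have 2: "x + (k2 + m) * t + (l2 + n) = Z" by (simp add: Y_def Z_def algebra_simps)
  have 3: "c1 * (Z / P)\<^sup>2 / (4 * (R / P)) = (c1 * a2 + d1 * c2) * Z\<^sup>2 / (4 * R) - c2 * Z\<^sup>2 / (4 * P)"
  proof -
    have "c1 + c2 * R = (c1 * a2 + d1 * c2) * P" using det P(1) R(1) by algebra
    then have "c1 * Z\<^sup>2 + c2 * Z\<^sup>2 * R = (c1 * a2 + d1 * c2) * Z\<^sup>2 * P" by algebra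
    then show ?thesis using P(2) R(2) by (simp add: field_simps power2_eq_square)
  qed
  have 4: "- c2 * Z\<^sup>2 / (4 * P) - k1 / 2 * (Y / P) - k1\<^sup>2 / 4 * ((a2 * t + b2) / P)
      + (c2 * Y\<^sup>2 / (4 * P) - k2 / 2 * x - k2\<^sup>2 / 4 * t) =
    (- (k1\<^sup>2 * a2 * b2 + 2 * k1 * l1 * b2 * c2 + l1\<^sup>2 * c2 * d2) / 4 - m * l2 / 2)
      - (k2 + m) / 2 * x - (k2 + m)\<^sup>2 / 4 * t" (is "?L = ?R")
  proof -
    define U V where "U = a2 * t + b2" and "V = m * t + n"
    have Q: "k1\<^sup>2 * a2 * b2 + 2 * k1 * l1 * b2 * c2 + l1\<^sup>2 * c2 * d2 = m * n - k1 * l1"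
    proof -
      have "k1\<^sup>2 * a2 * b2 + 2 * k1 * l1 * b2 * c2 + l1\<^sup>2 * c2 * d2 =
        m * n - k1 * l1 * (a2 * d2 - b2 * c2)"
        unfolding m_def n_def by (simp add: algebra_simps power2_eq_square)
      then show ?thesis using det by simp
    qed
    have PM: "P * m = k1 + c2 * V"
      using k1 by (simp add: P(1) V_def algebra_simps)
    have V: "V = k1 * U + l1 * P"
      by (simp add: V_def U_def P(1) m_def n_def algebra_simps)
    have Z: "Z = Y + V" by (simp add: Z_def V_def)
    have "4 * P * ?L = - c2 * Z\<^sup>2 - 2 * k1 * Y - k1\<^sup>2 * U + c2 * Y\<^sup>2
       - P * (2 * k2 * x + k2\<^sup>2 * t)"
      using P(2) by (simp add: field_simps U_def)
    also have "\<dots> = - 2 * Y * (P * m) - (P * m) * V + P * k1 * l1 - P * (2 * k2 * x + k2\<^sup>2 * t)"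
      unfolding PM Z by (simp add: V algebra_simps power2_eq_square)
    also have "\<dots> = - P * (k1\<^sup>2 * a2 * b2 + 2 * k1 * l1 * b2 * c2 + l1\<^sup>2 * c2 * d2 + 2 * m * l2
       + 2 * (k2 + m) * x + (k2 + m)\<^sup>2 * t)"
      unfolding Q x V_def by (simp add: algebra_simps power2_eq_square)
    also have "\<dots> = 4 * P * ?R"
      by (simp add: field_simps)
    finally show ?thesis using P(2) by simp
  qed
  show ?thesis
    unfolding Y_def[symmetric] m_def[symmetric] n_def[symmetric] 1 2 3 using 4 by simp
qed

lemma ess_trans_comp:
  assumes p: "p \<in> ess_params" and q: "q \<in> ess_params"
  shows "(ess_trans p \<circ>\<^sub>m ess_trans q) \<subseteq>\<^sub>m ess_trans (ess_pmult p q)"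
    and "\<exists>F. finite F \<and> (\<forall>t x u. t \<notin> F \<longrightarrow> (t, x, u) \<in> dom (ess_trans p \<circ>\<^sub>m ess_trans q))"
proof -
  obtain a1 b1 c1 d1 k1 l1 s1 where p': "p = (a1, b1, c1, d1, k1, l1, s1)" by (metis prod_cases7)
  obtain a2 b2 c2 d2 k2 l2 s2 where q': "q = (a2, b2, c2, d2, k2, l2, s2)" by (metis prod_cases7)
  have det: "a1 * d1 - b1 * c1 = 1" "s1 \<noteq> 0" "a2 * d2 - b2 * c2 = 1" "s2 \<noteq> 0"
    using p q by (auto simp: p' q' ess_params_def)
  let ?P = "\<lambda>t. c2 * t + d2" and ?R = "\<lambda>t. (c1 * a2 + d1 * c2) * t + (c1 * b2 + d1 * d2)"
  have den: "c1 * ((a2 * t + b2) / ?P t) + d1 = ?R t / ?P t" if "?P t \<noteq> 0" for t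
    using that by (simp add: field_simps)
  have comp: "(ess_trans p \<circ>\<^sub>m ess_trans q) (t, x, u) =
    (if ?P t \<noteq> 0 then ess_trans (ess_pmult p q) (t, x, u) else None)" for t x u
  proof (cases "?P t = 0 \<or> ?R t = 0")
    case True
    then show ?thesis using den[of t] by (auto simp: map_comp_def p' q' ess_trans_apply)
  next
    case False
    then have nz: "?P t \<noteq> 0" "?R t \<noteq> 0" by auto
    have num: "(a1 * ((a2 * t + b2) / ?P t) + b1) / (?R t / ?P t) =
      ((a1 * a2 + b1 * c2) * t + (a1 * b2 + b1 * d2)) / ?R t"
      using nz by (simp add: divide_simps) (simp add: algebra_simps)
    have xx: "((x + k2 * t + l2) / ?P t + k1 * ((a2 * t + b2) / ?P t) + l1) / (?R t / ?P t) =
      (x + (k2 + (k1 * a2 + l1 * c2)) * t + (l2 + (k1 * b2 + l1 * d2))) / ?R t"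
      using nz by (simp add: divide_simps) (simp add: algebra_simps)
    have R: "?R t = c1 * (a2 * t + b2) + d1 * ?P t" by (simp add: algebra_simps)
    have sq: "sqrt \<bar>?R t / ?P t\<bar> * sqrt \<bar>?P t\<bar> = sqrt \<bar>?R t\<bar>"
      using nz by (simp flip: real_sqrt_mult add: abs_divide)
    have uu: "s1 * r1 * exp e1 * (s2 * r2 * exp e2 * u) = s1 * s2 * exp f1 * r * exp f2 * u"
      if "r1 * r2 = r" "e1 + e2 = f1 + f2" for r1 r2 r e1 e2 f1 f2 :: real
    proof -
      have "exp e1 * exp e2 = exp f1 * exp f2" using that(2) by (simp add: exp_add[symmetric])
      then show ?thesis using that(1) by algebra
    qed
    have "ess_trans q (t, x, u) = Some ((a2 * t + b2) / ?P t, (x + k2 * t + l2) / ?P t,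
      s2 * sqrt \<bar>?P t\<bar> * exp (c2 * (x + k2 * t + l2)\<^sup>2 / (4 * ?P t) - k2 / 2 * x - k2\<^sup>2 / 4 * t) * u)"
      using nz by (simp only: q' ess_trans_apply if_True not_False_eq_True)
    moreover have "?R t / ?P t \<noteq> 0" using nz by simp
    ultimately show ?thesis
      unfolding map_comp_def p' q' ess_pmult.simps
      by (simp only: option.case ess_trans_apply den[OF nz(1)] nz if_True not_False_eq_True num xx
          uu[OF sq exponent_identity[OF det(3) refl nz(1) R nz(2)]])
  qed
  show "(ess_trans p \<circ>\<^sub>m ess_trans q) \<subseteq>\<^sub>m ess_trans (ess_pmult p q)"
    unfolding map_le_def by (auto simp: comp split: if_splits)
  have "c2 \<noteq> 0 \<or> d2 \<noteq> 0" using det by auto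
  then have "finite {t. ?P t = 0}" by (rule affine_zeros_finite)
  moreover have "finite {t. ?R t = 0}"
  proof (rule affine_zeros_finite, rule ccontr)
    assume "\<not> (c1 * a2 + d1 * c2 \<noteq> 0 \<or> c1 * b2 + d1 * d2 \<noteq> 0)"
    then have "c1 * a2 + d1 * c2 = 0" "c1 * b2 + d1 * d2 = 0" by auto
    then have "a1 * d1 - b1 * c1 = 0" using det(3) by algebra
    then show False using det(1) by simp
  qed
  ultimately have "finite ({t. ?P t = 0} \<union> {t. ?R t = 0})" by simp
  moreover have "\<forall>t x u. t \<notin> {t. ?P t = 0} \<union> {t. ?R t = 0} \<longrightarrow>
      (t, x, u) \<in> dom (ess_trans p \<circ>\<^sub>m ess_trans q)"
    by (simp add: dom_def comp) (simp add: p' q' ess_trans_apply)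
  ultimately show "\<exists>F. finite F \<and> (\<forall>t x u. t \<notin> F \<longrightarrow> (t, x, u) \<in> dom (ess_trans p \<circ>\<^sub>m ess_trans q))"
    by blast
qed

lemma ess_mult_trans:
  assumes p: "p \<in> ess_params" and q: "q \<in> ess_params"
  shows "\<exists>!\<Phi>. \<Phi> \<in> ess_carrier \<and> (ess_trans p \<circ>\<^sub>m ess_trans q) \<subseteq>\<^sub>m \<Phi>"
    and "ess_mult (ess_trans p) (ess_trans q) = ess_trans (ess_pmult p q)"
proof -
  obtain F where F: "finite F"
    "\<And>t x u. t \<notin> F \<Longrightarrow> (t, x, u) \<in> dom (ess_trans p \<circ>\<^sub>m ess_trans q)"
    using ess_trans_comp(2)[OF p q] by blast
  have in_carrier: "ess_trans (ess_pmult p q) \<in> ess_carrier"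
    using ess_pmult_in_params[OF p q] by (simp add: ess_carrier_def)
  have uniq: "\<Phi> = ess_trans (ess_pmult p q)"
    if *: "\<Phi> \<in> ess_carrier \<and> (ess_trans p \<circ>\<^sub>m ess_trans q) \<subseteq>\<^sub>m \<Phi>" for \<Phi>
  proof -
    have "\<Phi> \<in> ess_trans ` ess_params" using * by (simp add: ess_carrier_def)
    then obtain r where r: "\<Phi> = ess_trans r" "r \<in> ess_params" by (rule imageE)
    have "r = ess_pmult p q"
    proof (rule ess_trans_eqI[OF r(2) ess_pmult_in_params[OF p q] F(1)])
      fix t x u assume "t \<notin> F"
      then have dom: "(t, x, u) \<in> dom (ess_trans p \<circ>\<^sub>m ess_trans q)" by (rule F(2))
      have "(ess_trans p \<circ>\<^sub>m ess_trans q) (t, x, u) = ess_trans r (t, x, u)"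
        using * dom unfolding r(1) map_le_def by blast
      moreover have "(ess_trans p \<circ>\<^sub>m ess_trans q) (t, x, u) = ess_trans (ess_pmult p q) (t, x, u)"
        using ess_trans_comp(1)[OF p q] dom unfolding map_le_def by blast
      ultimately show "ess_trans r (t, x, u) = ess_trans (ess_pmult p q) (t, x, u)" by simp
    qed
    then show ?thesis using r by simp
  qed
  show "\<exists>!\<Phi>. \<Phi> \<in> ess_carrier \<and> (ess_trans p \<circ>\<^sub>m ess_trans q) \<subseteq>\<^sub>m \<Phi>"
    by (rule ex1I, rule conjI[OF in_carrier ess_trans_comp(1)[OF p q]], erule uniq)
  show "ess_mult (ess_trans p) (ess_trans q) = ess_trans (ess_pmult p q)"
    unfolding ess_mult_def
    by (rule the_equality, rule conjI[OF in_carrier ess_trans_comp(1)[OF p q]], erule uniq)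
qed

lemma ess_pmult_assoc:
  assumes "p \<in> ess_params" "q \<in> ess_params" "r \<in> ess_params"
  shows "ess_pmult (ess_pmult p q) r = ess_pmult p (ess_pmult q r)"
proof -
  obtain a1 b1 c1 d1 k1 l1 s1 where p': "p = (a1, b1, c1, d1, k1, l1, s1)" by (metis prod_cases7)
  obtain a2 b2 c2 d2 k2 l2 s2 where q': "q = (a2, b2, c2, d2, k2, l2, s2)" by (metis prod_cases7)
  obtain a3 b3 c3 d3 k3 l3 s3 where r': "r = (a3, b3, c3, d3, k3, l3, s3)" by (metis prod_cases7)
  have det: "a2 * d2 - b2 * c2 = 1" "a3 * d3 - b3 * c3 = 1"
    using assms by (auto simp: p' q' r' ess_params_def)
  have *: "S1 * S2 * exp e1 * S3 * exp e2 = S1 * (S2 * S3 * exp e3) * exp e4"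
    if "e1 + e2 = e3 + e4" for S1 S2 S3 e1 e2 e3 e4 :: real
  proof -
    have "exp e1 * exp e2 = exp e3 * exp e4" using that by (simp flip: exp_add)
    then show ?thesis by algebra
  qed
  show ?thesis
    unfolding p' q' r' ess_pmult.simps prod.inject
    apply (intro conjI)
          apply (simp_all add: algebra_simps)[6]
    apply (rule *)
    using det by algebra
qed

lemma group_ess_group: "group ess_group"
proof (rule groupI)
  show "\<one>\<^bsub>ess_group\<^esub> \<in> carrier ess_group"
    by (auto simp: ess_group_def ess_carrier_def ess_params_def Some_eq_ess_trans)
  fix x assume "x \<in> carrier ess_group"
  then obtain p where p: "p \<in> ess_params" "x = ess_trans p" by (auto simp: ess_group_def ess_carrier_def)
  have e: "(1, 0, 0, 1, 0, 0, 1) \<in> ess_params" by (simp add: ess_params_def)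
  show "\<one>\<^bsub>ess_group\<^esub> \<otimes>\<^bsub>ess_group\<^esub> x = x"
    by (cases p) (use p e in \<open>simp add: ess_group_def Some_eq_ess_trans ess_mult_trans\<close>)
  obtain a b c d k l s where p': "p = (a, b, c, d, k, l, s)" by (metis prod_cases7)
  have det: "a * d - b * c = 1" "s \<noteq> 0" using p by (auto simp: p' ess_params_def)
  let ?k = "c * l - d * k" and ?l = "b * k - a * l"
  define e where "e = - (?k\<^sup>2 * a * b + 2 * ?k * ?l * b * c + ?l\<^sup>2 * c * d) / 4 - (?k * a + ?l * c) * l / 2"
  define S where "S = exp (- e) / s"
  let ?q = "(d, - b, - c, a, ?k, ?l, S)"
  have "S \<noteq> 0" using det by (simp add: S_def)
  then have q: "?q \<in> ess_params" using det by (simp add: ess_params_def algebra_simps)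
  have 1: "?k * a + ?l * c = - k" using det by algebra
  have 2: "?k * b + ?l * d = - l" using det by algebra
  have "ess_pmult ?q p = (1, 0, 0, 1, 0, 0, 1)"
  proof -
    have "k + (?k * a + ?l * c) = 0" "l + (?k * b + ?l * d) = 0"
      "d * a + - b * c = 1" "- c * b + a * d = 1" "d * b + - b * d = 0" "- c * a + a * c = 0"
      unfolding 1 2 using det by (simp_all add: algebra_simps)
    then show ?thesis
      unfolding p' ess_pmult.simps e_def[symmetric] prod.inject
      using det(2) by (simp add: S_def exp_minus)
  qed
  then have "ess_trans ?q \<otimes>\<^bsub>ess_group\<^esub> x = \<one>\<^bsub>ess_group\<^esub>"
    using p q by (simp add: ess_group_def Some_eq_ess_trans ess_mult_trans)
  then show "\<exists>y\<in>carrier ess_group. y \<otimes>\<^bsub>ess_group\<^esub> x = \<one>\<^bsub>ess_group\<^esub>"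
    using q by (auto simp: ess_group_def ess_carrier_def intro!: bexI[of _ ?q])
next
  fix x y assume "x \<in> carrier ess_group" "y \<in> carrier ess_group"
  then show "x \<otimes>\<^bsub>ess_group\<^esub> y \<in> carrier ess_group"
    by (auto simp: ess_group_def ess_carrier_def ess_mult_trans ess_pmult_in_params
        simp del: ess_pmult.simps)
next
  fix x y z assume "x \<in> carrier ess_group" "y \<in> carrier ess_group" "z \<in> carrier ess_group"
  then show "x \<otimes>\<^bsub>ess_group\<^esub> y \<otimes>\<^bsub>ess_group\<^esub> z = x \<otimes>\<^bsub>ess_group\<^esub> (y \<otimes>\<^bsub>ess_group\<^esub> z)"
    by (auto simp: ess_group_def ess_carrier_def ess_mult_trans ess_pmult_in_params ess_pmult_assoc
        simp del: ess_pmult.simps)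
qed

end

theory Submission
  imports Defs
begin

text \<open>
  The group is \<open>SL\<^sub>2\<close> acting on the Heisenberg group, times \<open>{1, -1}\<close>, and \<open>J\<close> changes the sign of
  the matrix part. An element with \<open>\<sigma> > 0\<close> whose matrix \<open>A\<close> has nonnegative trace lies on an explicit
  one-parameter subgroup: \<open>A\<close> is elliptic or hyperbolic, and then the Heisenberg part can be
  conjugated into the centre, or \<open>A = I + N\<close> with \<open>N\<^sup>2 = 0\<close>, and the subgroup is polynomial. As either
  \<open>A\<close> or \<open>- A\<close> has nonnegative trace, \<open>J\<close> moves the complement of the exponential image into that
  image. The complement is nonempty, since exponentials are squares and so have trace at least \<open>-2\<close>.
\<close>

section \<open>One-parameter subgroups described by curves of parameters\<close>

lemma carrier_ess_group: "carrier ess_group = ess_trans ` ess_params"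
  by (simp add: ess_group_def ess_carrier_def)

lemma ess_group_mult_trans:
  "p \<in> ess_params \<Longrightarrow> q \<in> ess_params \<Longrightarrow>
    ess_trans p \<otimes>\<^bsub>ess_group\<^esub> ess_trans q = ess_trans (ess_pmult p q)"
  by (simp add: ess_group_def ess_mult_trans)

text \<open>Since \<open>ess_trans\<close> is injective on \<open>ess_params\<close>, the chart
  turns the curve back into \<open>p\<close>. A general \<open>S\<close> serves both the whole line
  and a path on an interval.\<close>

lemma continuous_map_ess_trans:
  assumes "continuous_on S p" and "\<And>s. s \<in> S \<Longrightarrow> p s \<in> ess_params"
  shows "continuous_map (top_of_set S) ess_topology (\<lambda>s. ess_trans (p s))"
  unfolding ess_topology_def
proof (rule continuous_map_pullback')
  have "continuous_map (top_of_set S) euclidean p"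
    using assms(1) by simp
  then show "continuous_map (top_of_set S) euclidean
      (inv_into ess_params ess_trans \<circ> (\<lambda>s. ess_trans (p s)))"
    by (rule continuous_map_eq) (simp add: assms(2) inj_on_ess_trans inv_into_f_f)
qed (auto simp: ess_carrier_def assms(2))

lemma ess_trans_has_vector_derivative:
  fixes a b c d k l \<sigma> :: "real \<Rightarrow> real"
  assumes deriv: "(a has_real_derivative a') (at 0)" "(b has_real_derivative b') (at 0)"
    "(c has_real_derivative c') (at 0)" "(d has_real_derivative d') (at 0)"
    "(k has_real_derivative k') (at 0)" "(l has_real_derivative l') (at 0)"
    "(\<sigma> has_real_derivative s') (at 0)"
    and init: "a 0 = 1" "b 0 = 0" "c 0 = 0" "d 0 = 1" "k 0 = 0" "l 0 = 0" "\<sigma> 0 = 1"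
  shows "((\<lambda>s. the (ess_trans (a s, b s, c s, d s, k s, l s, \<sigma> s) (t, x, u))) has_vector_derivative
    (a' * t + b' - t * (c' * t + d'), k' * t + l' - x * (c' * t + d'),
     (s' + (c' * t + d') / 2 + c' * x\<^sup>2 / 4 - k' / 2 * x) * u)) (at 0)"
proof -
  let ?D = "\<lambda>s. c s * t + d s"
  let ?T = "\<lambda>s. (a s * t + b s) / ?D s"
  let ?X = "\<lambda>s. (x + k s * t + l s) / ?D s"
  let ?U = "\<lambda>s. \<sigma> s * sqrt (?D s) *
    exp (c s * (x + k s * t + l s)\<^sup>2 / (4 * ?D s) - k s / 2 * x - (k s)\<^sup>2 / 4 * t) * u"
  have "isCont ?D 0"
    using deriv(3,4) by (intro continuous_intros DERIV_isCont)
  then have "eventually (\<lambda>s. ?D s > 0) (at 0)"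
    using init by (intro order_tendstoD(1)[of _ 1]) (auto simp: isCont_def)
  then have ev: "eventually (\<lambda>s. (?T s, ?X s, ?U s) =
      the (ess_trans (a s, b s, c s, d s, k s, l s, \<sigma> s) (t, x, u))) (at 0)"
    by eventually_elim (simp add: ess_trans_apply)
  have T: "(?T has_real_derivative a' * t + b' - t * (c' * t + d')) (at 0)"
    by (auto intro!: derivative_eq_intros deriv simp: init algebra_simps)
  have X: "(?X has_real_derivative k' * t + l' - x * (c' * t + d')) (at 0)"
    by (auto intro!: derivative_eq_intros deriv simp: init algebra_simps)
  have U: "(?U has_real_derivative (s' + (c' * t + d') / 2 + c' * x\<^sup>2 / 4 - k' / 2 * x) * u) (at 0)"
    by (auto intro!: derivative_eq_intros deriv simp: init field_simps)
  have "((\<lambda>s. (?T s, ?X s, ?U s)) has_vector_derivative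
    (a' * t + b' - t * (c' * t + d'), k' * t + l' - x * (c' * t + d'),
     (s' + (c' * t + d') / 2 + c' * x\<^sup>2 / 4 - k' / 2 * x) * u)) (at 0)"
    using T X U unfolding has_real_derivative_iff_has_vector_derivative has_vector_derivative_def
    by (intro has_vector_derivative_Pair[unfolded has_vector_derivative_def])
  then show ?thesis
    unfolding has_vector_derivative_def
    by (rule has_derivative_transform_eventually[OF _ ev]) (simp_all add: ess_trans_apply init)
qed

text \<open>The derivatives at 0 determine the generator; those elsewhere give continuity of the
  curve.\<close>

lemma ess_exp_imageI:
  fixes a b c d k l \<sigma> :: "real \<Rightarrow> real"
  defines "p \<equiv> \<lambda>s. (a s, b s, c s, d s, k s, l s, \<sigma> s)"
  assumes par: "\<And>s. p s \<in> ess_params" and hom: "\<And>r s. p (r + s) = ess_pmult (p r) (p s)"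
    and deriv: "\<And>s. (a has_real_derivative a' s) (at s)" "\<And>s. (b has_real_derivative b' s) (at s)"
    "\<And>s. (c has_real_derivative c' s) (at s)" "\<And>s. (d has_real_derivative d' s) (at s)"
    "\<And>s. (k has_real_derivative k' s) (at s)" "\<And>s. (l has_real_derivative l' s) (at s)"
    "\<And>s. (\<sigma> has_real_derivative s' s) (at s)"
  shows "ess_trans (p 1) \<in> ess_exp_image"
proof -
  interpret group ess_group by (rule group_ess_group)
  have grp: "ess_trans (p s) \<in> carrier ess_group" for s
    using par by (simp add: carrier_ess_group)
  have mult: "ess_trans (p (r + s)) = ess_trans (p r) \<otimes>\<^bsub>ess_group\<^esub> ess_trans (p s)" for r s
    using par by (simp add: ess_group_mult_trans hom)
  \<comment> \<open>The only idempotent of a group is its identity.\<close>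
  have "ess_trans (p 0) = \<one>\<^bsub>ess_group\<^esub>"
    using mult[of 0 0] grp[of 0] by (simp add: l_cancel_one')
  then have "ess_trans (p 0) = ess_trans (1, 0, 0, 1, 0, 0, 1)"
    by (simp add: ess_group_def Some_eq_ess_trans)
  then have "p 0 = (1, 0, 0, 1, 0, 0, 1)"
    using par[of 0] by (auto dest!: inj_onD[OF inj_on_ess_trans] simp: ess_params_def)
  then have init: "a 0 = 1" "b 0 = 0" "c 0 = 0" "d 0 = 1" "k 0 = 0" "l 0 = 0" "\<sigma> 0 = 1"
    by (auto simp: p_def)
  have det: "(\<lambda>s. a s * d s - b s * c s) = (\<lambda>s. 1)"
    using par by (auto simp: p_def ess_params_def)
  \<comment> \<open>Differentiating the determinant shows that the matrix part of the generator is
    traceless, so \<open>field_D\<close> alone accounts for its diagonal.\<close>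
  have "((\<lambda>s. a s * d s - b s * c s) has_real_derivative a' 0 + d' 0) (at 0)"
    by (rule derivative_eq_intros deriv refl | simp add: init)+
  then have tr: "d' 0 = - a' 0"
    unfolding det using DERIV_unique DERIV_const by fastforce
  \<comment> \<open>The coefficients are read off from the first-order terms; for instance, the
    \<open>t\<close>-component is \<open>b' 0 + 2 * a' 0 * t - c' 0 * t^2\<close>, whence the minus
    sign at \<open>field_K\<close>.\<close>
  define Q where "Q = (\<lambda>z.
    b' 0 *\<^sub>R field_Pt z + a' 0 *\<^sub>R field_D z + (- c' 0) *\<^sub>R field_K z +
    k' 0 *\<^sub>R field_Gx z + l' 0 *\<^sub>R field_Px z + s' 0 *\<^sub>R field_I z)"
  have "continuous_on UNIV a" "continuous_on UNIV b" "continuous_on UNIV c" "continuous_on UNIV d"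
    "continuous_on UNIV k" "continuous_on UNIV l" "continuous_on UNIV \<sigma>"
    using deriv DERIV_isCont by (blast intro: continuous_at_imp_continuous_on)+
  then have "continuous_on UNIV p"
    unfolding p_def by (intro continuous_intros)
  then have "continuous_map euclideanreal ess_topology (\<lambda>s. ess_trans (p s))"
    using continuous_map_ess_trans[of UNIV p] par by simp
  then have "one_param_subgroup (\<lambda>s. ess_trans (p s))"
    unfolding one_param_subgroup_def using mult grp by auto
  moreover have "((\<lambda>s. the (ess_trans (p s) z)) has_vector_derivative Q z) (at 0)" for z
  proof -
    obtain t x u where z: "z = (t, x, u)" by (metis prod_cases3)
    have "Q z = (a' 0 * t + b' 0 - t * (c' 0 * t + d' 0), k' 0 * t + l' 0 - x * (c' 0 * t + d' 0),
      (s' 0 + (c' 0 * t + d' 0) / 2 + c' 0 * x\<^sup>2 / 4 - k' 0 / 2 * x) * u)"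
      by (simp add: Q_def z tr field_Pt_def field_D_def field_K_def field_Gx_def field_Px_def
          field_I_def field_simps power2_eq_square)
    then show ?thesis
      unfolding p_def z by (simp only: ess_trans_has_vector_derivative[OF deriv init])
  qed
  ultimately have "generates Q (\<lambda>s. ess_trans (p s))"
    unfolding generates_def by blast
  moreover have "Q \<in> ess_algebra"
    unfolding ess_algebra_def Q_def by blast
  ultimately show ?thesis
    unfolding ess_exp_image_def by (intro CollectI exI[of _ "\<lambda>s. ess_trans (p s)"] exI[of _ Q]) simp
qed

text \<open>In the coordinate \<open>\<tau> = ln \<sigma> + \<lambda>\<^sub>1 \<lambda>\<^sub>0 / 4\<close> the cocycle of the group becomes a multiple of the
  standard symplectic form, invariant under \<open>SL\<^sub>2\<close>.\<close>

definition symp_params ::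
    "real \<Rightarrow> real \<Rightarrow> real \<Rightarrow> real \<Rightarrow> real \<Rightarrow> real \<Rightarrow> real \<Rightarrow> params"
  where "symp_params a b c d k l \<tau> = (a, b, c, d, k, l, exp (\<tau> - k * l / 4))"

text \<open>Let \<open>(m, n)\<close> be the row vector \<open>(k1, l1)\<close> times the second
  matrix. As that matrix has determinant 1, the quadratic form in the cocycle equals
  \<open>m * n - k1 * l1\<close>, and the shift by \<open>k * l / 4\<close> absorbs it.\<close>

lemma ess_pmult_symp_params:
  assumes "a2 * d2 - b2 * c2 = 1"
  shows "ess_pmult (symp_params a1 b1 c1 d1 k1 l1 \<tau>1) (symp_params a2 b2 c2 d2 k2 l2 \<tau>2) =
    symp_params (a1 * a2 + b1 * c2) (a1 * b2 + b1 * d2) (c1 * a2 + d1 * c2) (c1 * b2 + d1 * d2)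
      (k2 + (k1 * a2 + l1 * c2)) (l2 + (k1 * b2 + l1 * d2))
      (\<tau>1 + \<tau>2 + (k2 * (k1 * b2 + l1 * d2) - l2 * (k1 * a2 + l1 * c2)) / 4)"
proof -
  have "\<tau>1 - k1 * l1 / 4 + (\<tau>2 - k2 * l2 / 4)
      + (- (k1\<^sup>2 * a2 * b2 + 2 * k1 * l1 * b2 * c2 + l1\<^sup>2 * c2 * d2) / 4
         - (k1 * a2 + l1 * c2) * l2 / 2) =
    \<tau>1 + \<tau>2 + (k2 * (k1 * b2 + l1 * d2) - l2 * (k1 * a2 + l1 * c2)) / 4
      - (k2 + (k1 * a2 + l1 * c2)) * (l2 + (k1 * b2 + l1 * d2)) / 4"
    using assms by algebra
  then show ?thesis
    unfolding symp_params_def ess_pmult.simps by (simp flip: exp_add)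
qed

text \<open>The homomorphism condition has three layers: a matrix homomorphism, a cocycle
  \<open>(k, l)\<close> for its right action on row vectors, and \<open>\<tau>\<close>, additive up
  to the symplectic pairing.\<close>

lemma ess_exp_image_sympI:
  fixes a b c d k l \<tau> :: "real \<Rightarrow> real"
  assumes det: "\<And>s. a s * d s - b s * c s = 1"
    and mat: "\<And>r s. a (r + s) = a r * a s + b r * c s" "\<And>r s. b (r + s) = a r * b s + b r * d s"
    "\<And>r s. c (r + s) = c r * a s + d r * c s" "\<And>r s. d (r + s) = c r * b s + d r * d s"
    and vec: "\<And>r s. k (r + s) = k s + (k r * a s + l r * c s)"
    "\<And>r s. l (r + s) = l s + (k r * b s + l r * d s)"
    and scal: "\<And>r s. \<tau> (r + s) =
      \<tau> r + \<tau> s + (k s * (k r * b s + l r * d s) - l s * (k r * a s + l r * c s)) / 4"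
    and deriv: "\<And>s. (a has_real_derivative a' s) (at s)" "\<And>s. (b has_real_derivative b' s) (at s)"
    "\<And>s. (c has_real_derivative c' s) (at s)" "\<And>s. (d has_real_derivative d' s) (at s)"
    "\<And>s. (k has_real_derivative k' s) (at s)" "\<And>s. (l has_real_derivative l' s) (at s)"
    "\<And>s. (\<tau> has_real_derivative t' s) (at s)"
  shows "ess_trans (symp_params (a 1) (b 1) (c 1) (d 1) (k 1) (l 1) (\<tau> 1)) \<in> ess_exp_image"
  unfolding symp_params_def
proof (rule ess_exp_imageI[where \<sigma> = "\<lambda>s. exp (\<tau> s - k s * l s / 4)", OF _ _ deriv(1-6)])
  show "((\<lambda>s. exp (\<tau> s - k s * l s / 4)) has_real_derivative
     exp (\<tau> s - k s * l s / 4) * (t' s - (k' s * l s + k s * l' s) / 4)) (at s)" for s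
    by (rule derivative_eq_intros deriv refl | simp)+
  show "(a s, b s, c s, d s, k s, l s, exp (\<tau> s - k s * l s / 4)) \<in> ess_params" for s
    using det by (simp add: ess_params_def)
  show "(a (r + s), b (r + s), c (r + s), d (r + s), k (r + s), l (r + s),
      exp (\<tau> (r + s) - k (r + s) * l (r + s) / 4)) =
    ess_pmult (a r, b r, c r, d r, k r, l r, exp (\<tau> r - k r * l r / 4))
      (a s, b s, c s, d s, k s, l s, exp (\<tau> s - k s * l s / 4))" for r s
    unfolding ess_pmult_symp_params[OF det, unfolded symp_params_def]
    by (simp only: mat[symmetric] vec[symmetric] scal[symmetric])
qed

section \<open>Which elements are exponentials\<close>

text \<open>The matrix is \<open>I + N\<close> with \<open>N^2 = 0\<close>, so its powers are
  \<open>I + s * N\<close>. Interpolating the powers of the given element in \<open>s\<close> gives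
  a quadratic vector part and a cubic \<open>\<tau>\<close>.\<close>

lemma unipotent_in_ess_exp_image:
  assumes det: "a * d - b * c = 1" and tr: "a + d = 2"
  shows "ess_trans (symp_params a b c d k l \<tau>) \<in> ess_exp_image"
proof -
  define e where "e = a - 1"
  have a: "a = 1 + e" and d: "d = 1 - e" using tr by (simp_all add: e_def)
  have bc: "b * c = - e * e" using det unfolding a d by algebra
  \<comment> \<open>\<open>(m, n)\<close> is \<open>(k, l)\<close> times \<open>N\<close>;
    \<open>w\<close> below is the symplectic pairing of \<open>(k, l)\<close> with
    \<open>(m, n)\<close>.\<close>
  define m where "m = k * e + l * c"
  define n where "n = k * b - l * e"
  have mn: "m * e + n * c = 0" "m * b - n * e = 0"
    using bc unfolding m_def n_def by algebra+
  define w where "w = k * n - l * m"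
  \<comment> \<open>The corrections \<open>s * (s - 1) / 2\<close> and \<open>s ^ 3 - s\<close>
    vanish at \<open>s = 1\<close>, where the curve meets the given element.\<close>
  have "ess_trans (symp_params (1 + 1 * e) (1 * b) (1 * c) (1 - 1 * e)
      (1 * k + 1 * (1 - 1) / 2 * m) (1 * l + 1 * (1 - 1) / 2 * n)
      (1 * \<tau> + (1 ^ 3 - 1) / 24 * w)) \<in> ess_exp_image"
  proof (rule ess_exp_image_sympI[where a = "\<lambda>s. 1 + s * e" and b = "\<lambda>s. s * b" and
        c = "\<lambda>s. s * c" and d = "\<lambda>s. 1 - s * e" and k = "\<lambda>s. s * k + s * (s - 1) / 2 * m" and
        l = "\<lambda>s. s * l + s * (s - 1) / 2 * n" and \<tau> = "\<lambda>s. s * \<tau> + (s ^ 3 - s) / 24 * w"])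
    fix r s :: real
    show "(1 + s * e) * (1 - s * e) - s * b * (s * c) = 1" using bc by algebra
    show "1 + (r + s) * e = (1 + r * e) * (1 + s * e) + r * b * (s * c)" using bc by algebra
    show "(r + s) * b = (1 + r * e) * (s * b) + r * b * (1 - s * e)" by algebra
    show "(r + s) * c = r * c * (1 + s * e) + (1 - r * e) * (s * c)" by algebra
    show "1 - (r + s) * e = r * c * (s * b) + (1 - r * e) * (1 - s * e)" using bc by algebra
    have K: "(r * k + r * (r - 1) / 2 * m) * (1 + s * e) + (r * l + r * (r - 1) / 2 * n) * (s * c) =
        r * k + r * (r - 1) / 2 * m + r * s * m"
      using mn m_def by algebra
    have L: "(r * k + r * (r - 1) / 2 * m) * (s * b) + (r * l + r * (r - 1) / 2 * n) * (1 - s * e) =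
        r * l + r * (r - 1) / 2 * n + r * s * n"
      using mn n_def by algebra
    show "(r + s) * k + (r + s) * (r + s - 1) / 2 * m = s * k + s * (s - 1) / 2 * m +
      ((r * k + r * (r - 1) / 2 * m) * (1 + s * e) + (r * l + r * (r - 1) / 2 * n) * (s * c))"
      unfolding K by algebra
    show "(r + s) * l + (r + s) * (r + s - 1) / 2 * n = s * l + s * (s - 1) / 2 * n +
      ((r * k + r * (r - 1) / 2 * m) * (s * b) + (r * l + r * (r - 1) / 2 * n) * (1 - s * e))"
      unfolding L by algebra
    show "(r + s) * \<tau> + ((r + s) ^ 3 - (r + s)) / 24 * w =
      r * \<tau> + (r ^ 3 - r) / 24 * w + (s * \<tau> + (s ^ 3 - s) / 24 * w) +
      ((s * k + s * (s - 1) / 2 * m) * ((r * k + r * (r - 1) / 2 * m) * (s * b)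
          + (r * l + r * (r - 1) / 2 * n) * (1 - s * e)) -
       (s * l + s * (s - 1) / 2 * n) * ((r * k + r * (r - 1) / 2 * m) * (1 + s * e)
          + (r * l + r * (r - 1) / 2 * n) * (s * c))) / 4"
    proof -
      \<comment> \<open>By antisymmetry only multiples of \<open>w\<close> survive, and their
        coefficient is the additivity defect of a cube.\<close>
      have "(s * k + s * (s - 1) / 2 * m) * (r * l + r * (r - 1) / 2 * n + r * s * n)
          - (s * l + s * (s - 1) / 2 * n) * (r * k + r * (r - 1) / 2 * m + r * s * m)
        = (s * (r * (r - 1) / 2 + r * s) - r * (s * (s - 1) / 2)) * w"
        unfolding w_def by (simp add: field_simps)
      also have "s * (r * (r - 1) / 2 + r * s) - r * (s * (s - 1) / 2)
        = ((r + s) ^ 3 - r ^ 3 - s ^ 3) / 6"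
        by (simp add: field_simps power3_eq_cube)
      finally show ?thesis
        unfolding K L by (simp add: algebra_simps add_divide_distrib diff_divide_distrib)
    qed
  qed (rule derivative_eq_intros refl | simp)+
  then show ?thesis by (simp add: a d)
qed

text \<open>Here \<open>A - I\<close> is invertible, so that \<open>(\<lambda>\<^sub>1, \<lambda>\<^sub>0)\<close> is a coboundary: the element is conjugate
  to one with \<open>\<lambda>\<^sub>1 = \<lambda>\<^sub>0 = 0\<close>, by a translation with the parameters \<open>(w1, w0)\<close> below.\<close>

lemma semisimple_in_ess_exp_image:
  fixes C S :: "real \<Rightarrow> real"
  assumes det: "a * d - b * c = 1" and tr: "a + d = 2 * C 1" "a + d \<noteq> 2" and S1: "S 1 \<noteq> 0"
    and CS: "\<And>r s. C (r + s) = C r * C s + \<epsilon> * S r * S s" "\<And>r s. S (r + s) = S r * C s + C r * S s"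
    "\<And>s. (C s)\<^sup>2 - \<epsilon> * (S s)\<^sup>2 = 1"
    and deriv: "\<And>s. (C has_real_derivative C' s) (at s)" "\<And>s. (S has_real_derivative S' s) (at s)"
  shows "ess_trans (symp_params a b c d k l \<tau>) \<in> ess_exp_image"
proof -
  \<comment> \<open>With \<open>M\<close> the traceless matrix with rows \<open>(e, f)\<close> and
    \<open>(g, - e)\<close>, the given matrix is \<open>C 1 * I + S 1 * M\<close>. The determinant
    forces \<open>M^2 = \<epsilon> * I\<close>, so \<open>C s * I + S s * M\<close> is a
    subgroup.\<close>
  define e where "e = (a - d) / (2 * S 1)"
  define f where "f = b / S 1"
  define g where "g = c / S 1"
  have "S 1 * e = (a - d) / 2" using S1 by (simp add: e_def)
  then have A1: "a = C 1 + S 1 * e" "b = S 1 * f" "c = S 1 * g" "d = C 1 - S 1 * e"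
    using S1 tr(1) by (simp_all add: f_def g_def diff_divide_distrib)
  have "(S 1)\<^sup>2 * (e\<^sup>2 + f * g) = (S 1)\<^sup>2 * \<epsilon>"
    using det CS(3)[of 1] unfolding A1 by algebra
  then have eps: "\<epsilon> = e\<^sup>2 + f * g" using S1 by simp
  \<comment> \<open>Solves \<open>(w1, w0) (I - A) = (k, l)\<close> by the adjugate of
    \<open>I - A\<close>, whose determinant is \<open>2 - (a + d)\<close>.\<close>
  define w1 where "w1 = (k * (1 - d) + l * c) / (2 - (a + d))"
  define w0 where "w0 = (k * b + l * (1 - a)) / (2 - (a + d))"
  have w: "w1 * (2 - (a + d)) = k * (1 - d) + l * c" "w0 * (2 - (a + d)) = k * b + l * (1 - a)"
    using tr(2) by (simp_all add: w1_def w0_def)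
  have "(2 - (a + d)) * (w1 - (w1 * a + w0 * c)) = (2 - (a + d)) * k"
    "(2 - (a + d)) * (w0 - (w1 * b + w0 * d)) = (2 - (a + d)) * l"
    using w det by algebra+
  then have kl: "k = w1 - (w1 * a + w0 * c)" "l = w0 - (w1 * b + w0 * d)"
    using tr(2) by simp_all
  define A B G D where "A = (\<lambda>s. C s + S s * e)" and "B = (\<lambda>s. S s * f)" and "G = (\<lambda>s. S s * g)"
    and "D = (\<lambda>s. C s - S s * e)"
  \<comment> \<open>The pairing of \<open>(w1, w0)\<close> with its image under the matrix at
    \<open>s\<close>, which conjugation adds to the centre.\<close>
  define q where "q = (\<lambda>s. w1 * (w1 * B s + w0 * D s) - w0 * (w1 * A s + w0 * G s))"
  have detA: "A s * D s - B s * G s = 1" for s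
    using CS(3)[of s] unfolding A_def B_def G_def D_def eps by algebra
  have mat: "A (r + s) = A r * A s + B r * G s" "B (r + s) = A r * B s + B r * D s"
    "G (r + s) = G r * A s + D r * G s" "D (r + s) = G r * B s + D r * D s" for r s
    unfolding A_def B_def G_def D_def CS eps by algebra+
  \<comment> \<open>The central speed that makes the scalar coordinate equal \<open>\<tau>\<close>
    at time 1.\<close>
  define \<theta> where "\<theta> = \<tau> + q 1 / 4"
  have derivA: "(A has_real_derivative C' s + S' s * e) (at s)"
    "(B has_real_derivative S' s * f) (at s)" "(G has_real_derivative S' s * g) (at s)"
    "(D has_real_derivative C' s - S' s * e) (at s)" for s
    unfolding A_def B_def G_def D_def by (rule derivative_eq_intros deriv refl | simp)+
  have "ess_trans (symp_params (A 1) (B 1) (G 1) (D 1)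
      (w1 - (w1 * A 1 + w0 * G 1)) (w0 - (w1 * B 1 + w0 * D 1)) (\<theta> * 1 - q 1 / 4))
    \<in> ess_exp_image"
  proof (rule ess_exp_image_sympI[where a = A and b = B and c = G and d = D and
        k = "\<lambda>s. w1 - (w1 * A s + w0 * G s)" and l = "\<lambda>s. w0 - (w1 * B s + w0 * D s)" and
        \<tau> = "\<lambda>s. \<theta> * s - q s / 4", OF detA mat _ _ _ derivA])
    fix r s :: real
    show "w1 - (w1 * A (r + s) + w0 * G (r + s)) = w1 - (w1 * A s + w0 * G s) +
      ((w1 - (w1 * A r + w0 * G r)) * A s + (w0 - (w1 * B r + w0 * D r)) * G s)"
      unfolding mat by algebra
    show "w0 - (w1 * B (r + s) + w0 * D (r + s)) = w0 - (w1 * B s + w0 * D s) +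
      ((w1 - (w1 * A r + w0 * G r)) * B s + (w0 - (w1 * B r + w0 * D r)) * D s)"
      unfolding mat by algebra
    let ?k = "\<lambda>s. w1 * A s + w0 * G s" and ?l = "\<lambda>s. w1 * B s + w0 * D s"
    have k: "?k (r + s) = ?k r * A s + ?l r * G s" and l: "?l (r + s) = ?k r * B s + ?l r * D s"
      unfolding mat by algebra+
    \<comment> \<open>Invariance of the symplectic form under the matrix at
      \<open>s\<close>.\<close>
    have inv: "?k s * ?l (r + s) - ?l s * ?k (r + s) = q r"
    proof -
      have "?k s * ?l (r + s) - ?l s * ?k (r + s) = (A s * D s - B s * G s) * q r"
        unfolding k l q_def by algebra
      then show ?thesis by (simp add: detA)
    qed
    have "q (r + s) = w1 * ?l (r + s) - w0 * ?k (r + s)" "q s = w1 * ?l s - w0 * ?k s"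
      by (simp_all add: q_def)
    then have "q r + q s - q (r + s) = (w1 - ?k s) * (?l s - ?l (r + s)) - (w0 - ?l s) * (?k s - ?k (r + s))"
      unfolding inv[symmetric] by algebra
    also have "?l s - ?l (r + s) = (w1 - ?k r) * B s + (w0 - ?l r) * D s"
      unfolding l by algebra
    also have "?k s - ?k (r + s) = (w1 - ?k r) * A s + (w0 - ?l r) * G s"
      unfolding k by algebra
    finally show "\<theta> * (r + s) - q (r + s) / 4 = \<theta> * r - q r / 4 + (\<theta> * s - q s / 4) +
      ((w1 - ?k s) * ((w1 - ?k r) * B s + (w0 - ?l r) * D s)
       - (w0 - ?l s) * ((w1 - ?k r) * A s + (w0 - ?l r) * G s)) / 4"
      by (simp add: field_simps)
  qed (unfold q_def, (rule derivative_eq_intros derivA refl | simp)+)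
  moreover have "A 1 = a" "B 1 = b" "G 1 = c" "D 1 = d"
    by (simp_all add: A1 A_def B_def G_def D_def)
  ultimately show ?thesis
    by (simp add: kl \<theta>_def)
qed

lemma nonneg_trace_in_ess_exp_image:
  assumes det: "a * d - b * c = 1" and tr: "a + d \<ge> 0" and \<sigma>: "\<sigma> > 0"
  shows "ess_trans (a, b, c, d, k, l, \<sigma>) \<in> ess_exp_image"
proof -
  have "ess_trans (symp_params a b c d k l \<tau>) \<in> ess_exp_image" for \<tau>
  proof -
    consider "a + d < 2" | "a + d = 2" | "a + d > 2" by linarith
    then show ?thesis
    proof cases
      case 1
      define \<theta> where "\<theta> = arccos ((a + d) / 2)"
      have cos: "cos \<theta> = (a + d) / 2" using 1 tr by (simp add: \<theta>_def)
      \<comment> \<open>A zero would make the trace 2 or -2, both excluded here.\<close>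
      have "sin \<theta> \<noteq> 0"
      proof
        assume "sin \<theta> = 0"
        then have "(cos \<theta>)\<^sup>2 = 1\<^sup>2" using sin_cos_squared_add[of \<theta>] by simp
        then show False using 1 tr unfolding power2_eq_iff cos by auto
      qed
      then show ?thesis
        using 1 cos
        by (intro semisimple_in_ess_exp_image[OF det, where C = "\<lambda>s. cos (\<theta> * s)" and
              S = "\<lambda>s. sin (\<theta> * s)" and \<epsilon> = "-1" and C' = "\<lambda>s. - \<theta> * sin (\<theta> * s)" and
              S' = "\<lambda>s. \<theta> * cos (\<theta> * s)"])
          (auto intro!: derivative_eq_intros simp: distrib_left cos_add sin_add)
    next
      case 2
      then show ?thesis by (rule unipotent_in_ess_exp_image[OF det])
    next
      case 3
      define \<theta> where "\<theta> = arcosh ((a + d) / 2)"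
      have cosh: "cosh \<theta> = (a + d) / 2" using 3 by (simp add: \<theta>_def)
      have "sinh \<theta> \<noteq> 0"
      proof
        assume "sinh \<theta> = 0"
        then have "(cosh \<theta>)\<^sup>2 = 1\<^sup>2" by (simp add: cosh_square_eq)
        then show False using 3 unfolding power2_eq_iff cosh by auto
      qed
      then show ?thesis
        using 3 cosh
        by (intro semisimple_in_ess_exp_image[OF det, where C = "\<lambda>s. cosh (\<theta> * s)" and
              S = "\<lambda>s. sinh (\<theta> * s)" and \<epsilon> = 1 and C' = "\<lambda>s. \<theta> * sinh (\<theta> * s)" and
              S' = "\<lambda>s. \<theta> * cosh (\<theta> * s)"])
          (auto intro!: derivative_eq_intros simp: distrib_left cosh_add sinh_add cosh_square_eq)
    qed
  qed
  \<comment> \<open>This value undoes the change of coordinate, since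
    \<open>\<sigma> > 0\<close>.\<close>
  from this[of "ln \<sigma> + k * l / 4"] show ?thesis
    using \<sigma> by (simp add: symp_params_def)
qed

text \<open>Every element of the image is a square, and \<open>tr B\<^sup>2 = (tr B)\<^sup>2 - 2\<close> for \<open>B \<in> SL\<^sub>2\<close>.\<close>

lemma ess_exp_image_trace_ge:
  assumes "ess_trans (a, b, c, d, k, l, \<sigma>) \<in> ess_exp_image"
    and "(a, b, c, d, k, l, \<sigma>) \<in> ess_params"
  shows "a + d \<ge> - 2"
proof -
  obtain \<phi> where \<phi>: "one_param_subgroup \<phi>" "ess_trans (a, b, c, d, k, l, \<sigma>) = \<phi> 1"
    using assms(1) unfolding ess_exp_image_def generates_def by blast
  obtain q where q: "q \<in> ess_params" "\<phi> (1 / 2) = ess_trans q"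
    using \<phi>(1) unfolding one_param_subgroup_def carrier_ess_group by blast
  have "\<phi> (1 / 2 + 1 / 2) = \<phi> (1 / 2) \<otimes>\<^bsub>ess_group\<^esub> \<phi> (1 / 2)"
    using \<phi>(1) unfolding one_param_subgroup_def by blast
  then have "ess_trans (a, b, c, d, k, l, \<sigma>) = ess_trans (ess_pmult q q)"
    using \<phi>(2) q by (simp add: ess_group_mult_trans)
  then have eq: "(a, b, c, d, k, l, \<sigma>) = ess_pmult q q"
    using assms(2) q(1) ess_pmult_in_params inj_onD[OF inj_on_ess_trans] by blast
  obtain a' b' c' d' k' l' s' where q': "q = (a', b', c', d', k', l', s')" by (metis prod_cases7)
  have "a' * d' - b' * c' = 1" using q(1) by (simp add: q' ess_params_def)
  moreover have "a = a' * a' + b' * c'" "d = c' * b' + d' * d'"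
    using eq by (simp_all add: q')
  ultimately have "a + d = (a' + d')\<^sup>2 - 2" by algebra
  then show ?thesis by simp
qed

section \<open>Identity component and multiplication by \<open>transf_J\<close>\<close>

text \<open>The parameter \<open>\<sigma>\<close> is continuous, never 0, and 1 at the identity, so
  it stays positive on connected sets through the identity.\<close>

lemma ess_identity_component_pos:
  assumes "h \<in> identity_component ess_group ess_topology"
  obtains a b c d k l \<sigma> where "h = ess_trans (a, b, c, d, k, l, \<sigma>)" "a * d - b * c = 1" "\<sigma> > 0"
proof -
  let ?\<sigma> = "\<lambda>(a, b, c, d, k, l, \<sigma>). \<sigma> :: real"
  let ?inv = "inv_into ess_params ess_trans"
  have cont: "continuous_map ess_topology euclideanreal (?\<sigma> \<circ> ?inv)"
    unfolding ess_topology_def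
    by (intro continuous_map_pullback) (auto simp: case_prod_beta intro!: continuous_intros)
  obtain T where T: "connectedin ess_topology T" "Some \<in> T" "h \<in> T"
    using assms by (auto simp: identity_component_def connected_component_of_def ess_group_def)
  have sub: "T \<subseteq> ess_trans ` ess_params"
    using connectedin_subset_topspace[OF T(1)]
    by (auto simp: ess_topology_def topspace_pullback_topology ess_carrier_def)
  have conn: "connected ((?\<sigma> \<circ> ?inv) ` T)"
    using connectedin_continuous_map_image[OF cont T(1)] by simp
  have one: "(?\<sigma> \<circ> ?inv) Some = 1"
    unfolding Some_eq_ess_trans comp_def
    by (subst inv_into_f_f[OF inj_on_ess_trans]) (auto simp: ess_params_def)
  obtain a b c d k l \<sigma> where p: "h = ess_trans (a, b, c, d, k, l, \<sigma>)"
    "(a, b, c, d, k, l, \<sigma>) \<in> ess_params"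
    using sub T(3) by fastforce
  then have "(?\<sigma> \<circ> ?inv) h = \<sigma>"
    by (simp add: inv_into_f_f[OF inj_on_ess_trans])
  then have im: "\<sigma> \<in> (?\<sigma> \<circ> ?inv) ` T" "1 \<in> (?\<sigma> \<circ> ?inv) ` T"
    using T(2,3) one by force+
  have "0 \<notin> (?\<sigma> \<circ> ?inv) ` T"
  proof
    assume "0 \<in> (?\<sigma> \<circ> ?inv) ` T"
    then obtain p where "p \<in> ess_params" "?\<sigma> (?inv (ess_trans p)) = 0"
      using sub by fastforce
    then have "?\<sigma> p = 0"
      by (simp add: inv_into_f_f[OF inj_on_ess_trans])
    then show False
      using \<open>p \<in> ess_params\<close> by (auto simp: ess_params_def)
  qed
  then have "\<sigma> > 0"
    using connectedD_interval[OF conn im, of 0] by (meson not_less zero_le_one)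
  then show ?thesis
    using that p by (auto simp: ess_params_def)
qed

lemma negative_hyperbolic_in_identity_component:
  "ess_trans (- 2, 0, 0, - 1 / 2, 0, 0, 1) \<in> identity_component ess_group ess_topology"
proof -
  \<comment> \<open>The rotation by \<open>pi * s\<close> times the diagonal matrix with entries
    \<open>1 + s\<close> and \<open>1 / (1 + s)\<close>, of determinant 1 throughout.\<close>
  define p :: "real \<Rightarrow> params" where "p = (\<lambda>s. (cos (pi * s) * (1 + s), - sin (pi * s) / (1 + s),
    sin (pi * s) * (1 + s), cos (pi * s) / (1 + s), 0, 0, 1))"
  have "continuous_on {0..1} p"
    unfolding p_def by (intro continuous_intros) auto
  moreover have "p s \<in> ess_params" if "s \<in> {0..1}" for s
  proof -
    have "cos (pi * s) * cos (pi * s) + sin (pi * s) * sin (pi * s) = 1"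
      using sin_cos_squared_add3 by blast
    then show ?thesis using that by (simp add: p_def ess_params_def)
  qed
  ultimately have "continuous_map (top_of_set {0..1}) ess_topology (\<lambda>s. ess_trans (p s))"
    by (rule continuous_map_ess_trans)
  then have "connectedin ess_topology ((\<lambda>s. ess_trans (p s)) ` {0..1})"
    by (rule connectedin_continuous_map_image) (simp add: connectedin_subtopology)
  moreover have "p 0 = (1, 0, 0, 1, 0, 0, 1)" "p 1 = (- 2, 0, 0, - 1 / 2, 0, 0, 1)"
    by (simp_all add: p_def)
  then have "Some \<in> (\<lambda>s. ess_trans (p s)) ` {0..1}"
    "ess_trans (- 2, 0, 0, - 1 / 2, 0, 0, 1) \<in> (\<lambda>s. ess_trans (p s)) ` {0..1}"
    unfolding Some_eq_ess_trans by (auto intro: rev_image_eqI[of 0] rev_image_eqI[of 1])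
  ultimately show ?thesis
    unfolding identity_component_def connected_component_of_def ess_group_def by auto
qed

theorem corollary13: "pseudo_discrete ess_group ess_topology ess_exp_image transf_J"
  unfolding pseudo_discrete_def
proof (intro conjI)
  show "ess_exp_image \<noteq> identity_component ess_group ess_topology"
    \<comment> \<open>This element has trace -5/2, below the bound -2 for exponentials.\<close>
    using negative_hyperbolic_in_identity_component
      ess_exp_image_trace_ge[of "- 2" 0 0 "- 1 / 2" 0 0 1]
    by (auto simp: ess_params_def)
  have J: "(- 1, 0, 0, - 1, 0, 0, 1) \<in> ess_params" by (simp add: ess_params_def)
  then show "transf_J \<in> carrier ess_group"
    by (simp add: carrier_ess_group transf_J_eq)
  show "(\<lambda>h. transf_J \<otimes>\<^bsub>ess_group\<^esub> h) `
      (identity_component ess_group ess_topology - ess_exp_image) \<subseteq> ess_exp_image"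
  proof clarify
    fix h assume h: "h \<in> identity_component ess_group ess_topology" "h \<notin> ess_exp_image"
    obtain a b c d k l \<sigma> where p: "h = ess_trans (a, b, c, d, k, l, \<sigma>)"
      "a * d - b * c = 1" "\<sigma> > 0"
      using h(1) by (rule ess_identity_component_pos)
    have "a + d < 0"
      using nonneg_trace_in_ess_exp_image[of a d b c \<sigma> k l] h(2) p by fastforce
    \<comment> \<open>Left multiplication by \<open>transf_J\<close> negates the matrix and keeps
      \<open>k\<close>, \<open>l\<close> and \<open>\<sigma>\<close>.\<close>
    then have "ess_trans (- a, - b, - c, - d, k, l, \<sigma>) \<in> ess_exp_image"
      using p by (intro nonneg_trace_in_ess_exp_image) auto
    then show "transf_J \<otimes>\<^bsub>ess_group\<^esub> h \<in> ess_exp_image"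
      unfolding transf_J_eq p(1) using p J
      by (subst ess_group_mult_trans) (auto simp: ess_params_def)
  qed
qed

end
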